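(* There is a constant $C>0$ such that for all sufficiently large $d$ the following holds. If $G$ is a simple, finite, loopless, $n$-vertex, $d$-regular graph containing an independent set of size at least $Cn/d$, then $$ \mathrm{hom}(G,H_{\mathrm{WR}}) < \mathrm{hom}(K_{d+1},H_{\mathrm{WR}})^{\frac{n}{d+1}}. $$
   Context: $H_{\mathrm{WR}}$ (the Widom–Rowlinson graph) is the path on three vertices with a loop at every vertex. For graphs $G$ and $H$, $\mathrm{hom}(G,H)$ is the number of maps $f:V(G)\to V(H)$ such that $uv\in E(G)$ implies $f(u)f(v)\in E(H)$. $K_{d+1}$ is the complete loopless graph on $d+1$ vertices. *)

theory Defs
  imports Complex_Main "HOL-Library.FuncSet" "Graph_Theory.Kuratowski"
begin

text \<open>
  Undirected graphs are digraphs without parallel arcs whose arc relation is symmetric, an edge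
  \<open>uv\<close> being the pair of arcs \<open>(u,v)\<close>, \<open>(v,u)\<close> and a loop at \<open>v\<close> the single arc \<open>(v,v)\<close>. Finite simple
  loopless graphs are the models of \<^locale>\<open>pair_graph\<close>; finite graphs in which loops are permitted
  are the models of \<^locale>\<open>pair_pseudo_graph\<close>.
\<close>

text \<open>
  Homomorphisms are taken to be extensional (\<open>undefined\<close> off \<open>V(G)\<close>), so that each map
  \<open>V(G) \<Rightarrow> V(H)\<close> is counted exactly once.
\<close>

definition graph_homs :: "'a pair_pre_digraph \<Rightarrow> 'b pair_pre_digraph \<Rightarrow> ('a \<Rightarrow> 'b) set" where
  "graph_homs G H =
    {f \<in> pverts G \<rightarrow>\<^sub>E pverts H. \<forall>(u, v) \<in> parcs G. (f u, f v) \<in> parcs H}"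

definition hom_count :: "'a pair_pre_digraph \<Rightarrow> 'b pair_pre_digraph \<Rightarrow> nat" where
  "hom_count G H = card (graph_homs G H)"

definition H_WR :: "nat pair_pre_digraph" where
  "H_WR = \<lparr> pverts = {0, 1, 2},
            parcs = {(0, 1), (1, 0), (1, 2), (2, 1)} \<union> {(0, 0), (1, 1), (2, 2)} \<rparr>"

definition complete_graph :: "nat \<Rightarrow> nat pair_pre_digraph" where
  "complete_graph m = \<lparr> pverts = {..<m}, parcs = {(u, v). u < m \<and> v < m \<and> u \<noteq> v} \<rparr>"

text \<open>
  In a loopless symmetric digraph the out-degree of a vertex is its degree as a vertex of the
  undirected graph.
\<close>

definition regular_graph :: "nat \<Rightarrow> 'a pair_pre_digraph \<Rightarrow> bool" where
  "regular_graph d G \<longleftrightarrow> (\<forall>v \<in> pverts G. out_degree (with_proj G) v = d)"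

definition independent_set :: "'a pair_pre_digraph \<Rightarrow> 'a set \<Rightarrow> bool" where
  "independent_set G I \<longleftrightarrow> I \<subseteq> pverts G \<and> (\<forall>u \<in> I. \<forall>v \<in> I. (u, v) \<notin> parcs G)"

lemma pair_pseudo_graph_H_WR: "pair_pseudo_graph H_WR"
  by unfold_locales (auto simp: H_WR_def symmetric_def intro!: symI)

lemma complete_digraph_complete_graph: "complete_digraph m (with_proj (complete_graph m))"
  by (auto simp: complete_digraph_pair_def complete_graph_def)

lemma pair_graph_complete_graph: "pair_graph (complete_graph m)"
  using complete_digraph_complete_graph by (rule pair_graphI_complete)

end

theory Submission
  imports Defs
begin

text \<open>
  Let \<open>f\<close> be a uniformly random homomorphism and order the vertices. The chain rule for the entropy of
  \<open>f\<close>, taken with weight \<open>p/d\<close> at a vertex with \<open>p\<close> earlier neighbours and with weight \<open>(d - p)/d\<close>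
  shared among its later neighbours, gives the bound of Madiman and Tetali
  \<open>hom(G,H)\<^sup>d \<le> \<Prod>\<^sub>v hom(K\<^bsub>p(v),p(v)\<^esub>,H)\<close>. For the Widom--Rowlinson graph
  \<open>hom(K\<^bsub>p,p\<^esub>,H) \<le> 2 * 4\<^sup>p * (1 + (3/4)\<^sup>p)\<close>, and the value is 1 for \<open>p = 0\<close>. If the independent set \<open>I\<close>
  comes first, its vertices have \<open>p = 0\<close> and each saves a factor 2 in \<open>hom(G,H)\<^sup>d\<close>, while averaging over the orders
  of the other vertices makes the sum of \<open>(3/4)\<^sup>p\<close> at most \<open>16n/(d + 1)\<close>. Altogether
  \<open>d * ln hom(G) \<le> (nd + n - |I|) * ln 2 + 16n/(d + 1)\<close>, which for \<open>|I| \<ge> 40n/d\<close> is less than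
  \<open>dn/(d + 1) * ln (2\<^bsup>d+2\<^esup> - 1)\<close>.
\<close>

section \<open>Vertex orders as lists\<close>

definition preds :: "'a list \<Rightarrow> 'a \<Rightarrow> 'a set" where
  "preds xs v = set (takeWhile (\<lambda>u. u \<noteq> v) xs)"

lemma preds_Cons: "preds (u # xs) v = (if u = v then {} else insert u (preds xs v))"
  by (auto simp: preds_def)

text \<open>If \<open>v\<close> does not occur in \<open>xs\<close>, then \<open>takeWhile\<close>
  runs through the whole list, so all of \<open>set xs\<close> counts as earlier than
  \<open>v\<close>.\<close>

lemma preds_append: "preds (xs @ ys) v = (if v \<in> set xs then preds xs v else set xs \<union> preds ys v)"
  by (induction xs) (auto simp: preds_Cons)

lemma preds_subset: "preds xs v \<subseteq> set xs"
  by (auto simp: preds_def dest: set_takeWhileD)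

lemma finite_preds [simp]: "finite (preds xs v)"
  by (simp add: preds_def)

text \<open>This makes every edge point from exactly one earlier end to one later end, so that the
  neighbours of a vertex split into earlier and later ones.\<close>

lemma preds_total:
  assumes "u \<in> set xs" "v \<in> set xs" "u \<noteq> v"
  shows "u \<in> preds xs v \<longleftrightarrow> v \<notin> preds xs u"
  using assms
proof (induction xs)
  case (Cons x xs)
  have "y \<notin> preds ys y" for y :: 'a and ys by (auto simp: preds_def dest: set_takeWhileD)
  then show ?case using Cons preds_subset[of xs] by (auto simp: preds_Cons)
qed simp

section \<open>The chain rule for a random element of a finite set of maps\<close>

text \<open>
  Reveal the values of a uniformly random element of \<open>F\<close> in the order of the list; this is the
  reciprocal of the conditional probability that the value at \<open>w\<close> is \<open>f w\<close>, given that the earlier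
  values agree with those of \<open>f\<close>.
\<close>

primrec inv_cond_prob :: "'a list \<Rightarrow> ('a \<Rightarrow> 'b) set \<Rightarrow> ('a \<Rightarrow> 'b) \<Rightarrow> 'a \<Rightarrow> real" where
  "inv_cond_prob [] F f w = 1"
| "inv_cond_prob (v # xs) F f w =
    (if w = v then real (card F) / real (card {g \<in> F. g v = f v})
     else inv_cond_prob xs {g \<in> F. g v = f v} f w)"

lemma inv_cond_prob_pos:
  assumes "finite F" "f \<in> F"
  shows "inv_cond_prob xs F f w > 0"
  using assms
proof (induction xs arbitrary: F)
  case (Cons v xs)
  have "card F > 0" "card {g \<in> F. g v = f v} > 0"
    using Cons.prems by (auto simp: card_gt_0_iff)
  then show ?case using Cons by auto
qed simp

text \<open>The product telescopes: each factor is the quotient of the sizes of two successive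
  fibres.\<close>

lemma prod_inv_cond_prob:
  assumes "finite F" "f \<in> F" "distinct xs"
  shows "(\<Prod>w\<in>set xs. inv_cond_prob xs F f w)
    = real (card F) / real (card {g \<in> F. \<forall>u\<in>set xs. g u = f u})"
  using assms
proof (induction xs arbitrary: F)
  case Nil
  then have "card F > 0" by (auto simp: card_gt_0_iff)
  then show ?case by simp
next
  case (Cons v xs)
  let ?F = "{g \<in> F. g v = f v}"
  have pos: "card ?F > 0"
    using Cons.prems by (auto simp: card_gt_0_iff)
  define m where "m = real (card {g \<in> F. \<forall>u\<in>set (v # xs). g u = f u})"
  have "(\<Prod>w\<in>set xs. inv_cond_prob (v # xs) F f w) = (\<Prod>w\<in>set xs. inv_cond_prob xs ?F f w)"
    using Cons.prems by (intro prod.cong) auto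
  also have "\<dots> = real (card ?F) / real (card {g \<in> ?F. \<forall>u\<in>set xs. g u = f u})"
    using Cons by auto
  also have "{g \<in> ?F. \<forall>u\<in>set xs. g u = f u} = {g \<in> F. \<forall>u\<in>set (v # xs). g u = f u}"
    by auto
  finally have tl: "(\<Prod>w\<in>set xs. inv_cond_prob (v # xs) F f w) = real (card ?F) / m"
    unfolding m_def .
  have "(\<Prod>w\<in>set (v # xs). inv_cond_prob (v # xs) F f w)
    = inv_cond_prob (v # xs) F f v * (real (card ?F) / m)"
    using Cons.prems unfolding tl[symmetric] by (simp del: inv_cond_prob.simps)
  also have "\<dots> = real (card F) / m" using pos by simp
  finally show ?case unfolding m_def .
qed

lemma sum_fibres:
  fixes h :: "('a \<Rightarrow> 'b) \<Rightarrow> real"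
  assumes "finite F" "finite C" "\<And>f. f \<in> F \<Longrightarrow> f v \<in> C"
  shows "(\<Sum>f\<in>F. h f) = (\<Sum>x\<in>C. \<Sum>f | f \<in> F \<and> f v = x. h f)"
  using assms by (subst sum.group) auto

lemma card_fibres:
  assumes "finite F" "finite C" "\<And>f. f \<in> F \<Longrightarrow> f v \<in> C"
  shows "real (card F) = (\<Sum>x\<in>C. real (card {f \<in> F. f v = x}))"
  using sum_fibres[OF assms, where h = "\<lambda>_. 1"] by simp

text \<open>Divide by \<open>card F\<close> to read the left side as an expectation, and reveal the
  first vertex \<open>v\<close> of the list. If \<open>v\<close> is in \<open>A\<close>, its factor
  cancels the probability of the fibre, and the average over fibres becomes a plain sum over the
  values in \<open>C\<close>. Otherwise the bounds for the fibres are averaged. Values that never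
  occur account for the inequality.\<close>

lemma sum_prod_inv_cond_prob_le:
  fixes \<phi> :: "('a \<Rightarrow> 'b) \<Rightarrow> real"
  assumes "finite F" "finite C" "\<And>f u. f \<in> F \<Longrightarrow> u \<in> set xs \<Longrightarrow> f u \<in> C"
    "distinct xs" "A \<subseteq> set xs" "\<And>g. \<phi> g \<ge> 0"
  shows "(\<Sum>f\<in>F. (\<Prod>w\<in>A. inv_cond_prob xs F f w) * \<phi> (restrict f A))
    \<le> real (card F) * (\<Sum>g\<in>A \<rightarrow>\<^sub>E C. \<phi> g)"
  using assms
proof (induction xs arbitrary: F A \<phi>)
  case Nil
  then have [simp]: "A = {}" by simp
  show ?case by (simp add: restrict_def)
next
  case (Cons v xs)
  let ?F = "\<lambda>x. {f \<in> F. f v = x}"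
  let ?h = "\<lambda>f. (\<Prod>w\<in>A. inv_cond_prob (v # xs) F f w) * \<phi> (restrict f A)"
  have finA: "finite A" using Cons.prems by (auto intro: finite_subset)
  have split: "(\<Sum>f\<in>F. ?h f) = (\<Sum>x\<in>C. \<Sum>f\<in>?F x. ?h f)"
    using Cons.prems by (intro sum_fibres) auto
  show ?case
  proof (cases "v \<in> A")
    case True
    define B where "B = A - {v}"
    have A: "A = insert v B" and vB: "v \<notin> B" and finB: "finite B" and Bxs: "B \<subseteq> set xs"
      using True finA Cons.prems by (auto simp: B_def)
    have inner: "(\<Sum>f\<in>?F x. ?h f) \<le> real (card F) * (\<Sum>g\<in>B \<rightarrow>\<^sub>E C. \<phi> (g(v := x)))" for x
    proof (cases "?F x = {}")
      case True
      show ?thesis unfolding True using Cons.prems by (auto intro!: mult_nonneg_nonneg sum_nonneg)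
    next
      case False
      then have pos: "card (?F x) > 0" using Cons.prems by (auto simp: card_gt_0_iff)
      \<comment> \<open>The factor at \<open>v\<close> is constant on the fibre; the others are
        those of the tail \<open>xs\<close> inside the fibre. The value \<open>x\<close> at
        \<open>v\<close> is absorbed into the weight function to which the induction hypothesis is
        applied.\<close>
      have "?h f = real (card F) / real (card (?F x)) *
        ((\<Prod>w\<in>B. inv_cond_prob xs (?F x) f w) * \<phi> ((restrict f B)(v := x)))"
        if "f \<in> ?F x" for f
      proof -
        have 1: "restrict f A = (restrict f B)(v := x)"
          using that by (auto simp: A restrict_def)
        have 2: "(\<Prod>w\<in>B. inv_cond_prob (v # xs) F f w) = (\<Prod>w\<in>B. inv_cond_prob xs (?F x) f w)"
          using that vB by (intro prod.cong) auto
        have "(\<Prod>w\<in>A. inv_cond_prob (v # xs) F f w)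
          = inv_cond_prob (v # xs) F f v * (\<Prod>w\<in>B. inv_cond_prob (v # xs) F f w)"
          using vB finB unfolding A by (rule prod.insert[rotated])
        also have "\<dots> = real (card F) / real (card (?F x)) * (\<Prod>w\<in>B. inv_cond_prob xs (?F x) f w)"
          using that unfolding 2 by simp
        finally show ?thesis unfolding 1 by (simp only: mult.assoc)
      qed
      then have "(\<Sum>f\<in>?F x. ?h f) = real (card F) / real (card (?F x)) *
        (\<Sum>f\<in>?F x. (\<Prod>w\<in>B. inv_cond_prob xs (?F x) f w) * \<phi> ((restrict f B)(v := x)))"
        unfolding sum_distrib_left by (intro sum.cong) auto
      also have "\<dots> \<le> real (card F) / real (card (?F x)) *
         (real (card (?F x)) * (\<Sum>g\<in>B \<rightarrow>\<^sub>E C. \<phi> (g(v := x))))"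
        using Cons.prems Bxs
        by (intro mult_left_mono Cons.IH[where \<phi> = "\<lambda>g. \<phi> (g(v := x))"]) auto
      finally show ?thesis using pos by simp
    qed
    have "(\<Sum>g\<in>A \<rightarrow>\<^sub>E C. \<phi> g) = (\<Sum>(x, g)\<in>C \<times> (B \<rightarrow>\<^sub>E C). \<phi> (g(v := x)))"
      unfolding A PiE_insert_eq using inj_combinator[OF vB, where T = "\<lambda>_. C"]
      by (subst sum.reindex) (auto simp: case_prod_unfold)
    also have "\<dots> = (\<Sum>x\<in>C. \<Sum>g\<in>B \<rightarrow>\<^sub>E C. \<phi> (g(v := x)))"
      by (simp add: sum.cartesian_product)
    finally have "real (card F) * (\<Sum>g\<in>A \<rightarrow>\<^sub>E C. \<phi> g)
      = (\<Sum>x\<in>C. real (card F) * (\<Sum>g\<in>B \<rightarrow>\<^sub>E C. \<phi> (g(v := x))))"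
      by (simp add: sum_distrib_left)
    then show ?thesis unfolding split using inner by (simp only: sum_mono)
  next
    case False
    have inner: "(\<Sum>f\<in>?F x. ?h f) \<le> real (card (?F x)) * (\<Sum>g\<in>A \<rightarrow>\<^sub>E C. \<phi> g)" for x
    proof -
      have "(\<Prod>w\<in>A. inv_cond_prob (v # xs) F f w) = (\<Prod>w\<in>A. inv_cond_prob xs (?F x) f w)"
        if "f \<in> ?F x" for f
        using False that by (intro prod.cong) auto
      then have "(\<Sum>f\<in>?F x. ?h f)
        = (\<Sum>f\<in>?F x. (\<Prod>w\<in>A. inv_cond_prob xs (?F x) f w) * \<phi> (restrict f A))"
        by (intro sum.cong) auto
      also have "\<dots> \<le> real (card (?F x)) * (\<Sum>g\<in>A \<rightarrow>\<^sub>E C. \<phi> g)"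
        using Cons.prems False by (intro Cons.IH) auto
      finally show ?thesis .
    qed
    have "real (card F) = (\<Sum>x\<in>C. real (card (?F x)))"
      using Cons.prems by (intro card_fibres) auto
    then have "real (card F) * (\<Sum>g\<in>A \<rightarrow>\<^sub>E C. \<phi> g)
      = (\<Sum>x\<in>C. real (card (?F x)) * (\<Sum>g\<in>A \<rightarrow>\<^sub>E C. \<phi> g))"
      by (simp add: sum_distrib_right)
    then show ?thesis unfolding split using inner by (simp only: sum_mono)
  qed
qed

text \<open>Given the values before \<open>v\<close>, each value that occurs at \<open>v\<close>
  contributes its probability times the reciprocal, that is 1. The conditional mean is therefore the
  number of occurring values over \<open>card (K f)\<close>, and all of them lie in
  \<open>K f\<close>, which the earlier values determine.\<close>

lemma sum_inv_cond_prob_le: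
  fixes K :: "('a \<Rightarrow> 'b) \<Rightarrow> 'b set"
  assumes "finite F" "finite C" "\<And>f u. f \<in> F \<Longrightarrow> u \<in> set xs \<Longrightarrow> f u \<in> C"
    "v \<in> set xs" "\<And>f. f \<in> F \<Longrightarrow> f v \<in> K f" "\<And>f. finite (K f)"
    "\<And>f g. f \<in> F \<Longrightarrow> g \<in> F \<Longrightarrow> (\<And>u. u \<in> preds xs v \<Longrightarrow> f u = g u) \<Longrightarrow> K f = K g"
  shows "(\<Sum>f\<in>F. inv_cond_prob xs F f v / real (card (K f))) \<le> real (card F)"
  using assms
proof (induction xs arbitrary: F)
  case Nil
  show ?case using Nil.prems(4) by (metis empty_iff list.set(1))
next
  case (Cons u xs)
  let ?F = "\<lambda>x. {f \<in> F. f u = x}"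
  show ?case
  proof (cases "v = u")
    case True
    show ?thesis
    proof (cases "F = {}")
      case False
      then obtain f0 where f0: "f0 \<in> F" by auto
      have K: "K f = K f0" if "f \<in> F" for f
        using Cons.prems(7)[OF that f0] True by (simp add: preds_Cons)
      have "f u \<in> K f0" if "f \<in> F" for f using Cons.prems(5)[OF that] K[OF that] True by simp
      then have "(\<Sum>f\<in>F. inv_cond_prob (u # xs) F f v / real (card (K f)))
        = (\<Sum>x\<in>K f0. \<Sum>f\<in>?F x. inv_cond_prob (u # xs) F f v / real (card (K f)))"
        using Cons.prems(1,6) by (intro sum_fibres) auto
      also have "\<dots> \<le> (\<Sum>x\<in>K f0. real (card F) / real (card (K f0)))"
      proof (intro sum_mono)
        fix x
        have "(\<Sum>f\<in>?F x. inv_cond_prob (u # xs) F f v / real (card (K f)))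
          = (\<Sum>f\<in>?F x. real (card F) / real (card (?F x)) / real (card (K f0)))"
          using True K by (intro sum.cong) auto
        also have "\<dots> = real (card (?F x)) * (real (card F) / real (card (?F x)) / real (card (K f0)))"
          by simp
        \<comment> \<open>A nonempty fibre gives equality, an empty one contributes 0.\<close>
        also have "\<dots> \<le> real (card F) / real (card (K f0))"
          by (cases "card (?F x) = 0") auto
        finally show "(\<Sum>f\<in>?F x. inv_cond_prob (u # xs) F f v / real (card (K f)))
          \<le> real (card F) / real (card (K f0))" .
      qed
      also have "\<dots> \<le> real (card F)" by (cases "card (K f0) = 0") auto
      finally show ?thesis .
    qed simp
  next
    case False
    have "(\<Sum>f\<in>F. inv_cond_prob (u # xs) F f v / real (card (K f)))
      = (\<Sum>x\<in>C. \<Sum>f\<in>?F x. inv_cond_prob (u # xs) F f v / real (card (K f)))"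
      using Cons.prems(1,2,3) by (intro sum_fibres) auto
    also have "\<dots> = (\<Sum>x\<in>C. \<Sum>f\<in>?F x. inv_cond_prob xs (?F x) f v / real (card (K f)))"
      using False by (intro sum.cong) auto
    also have "\<dots> \<le> (\<Sum>x\<in>C. real (card (?F x)))"
    proof (intro sum_mono Cons.IH)
      fix x f g assume "f \<in> ?F x" "g \<in> ?F x" "\<And>w. w \<in> preds xs v \<Longrightarrow> f w = g w"
      then show "K f = K g" using False by (intro Cons.prems(7)) (auto simp: preds_Cons)
    qed (use Cons.prems(1-6) False in auto)
    also have "\<dots> = real (card F)"
      using Cons.prems(1,2,3) by (intro card_fibres[symmetric]) auto
    finally show ?thesis .
  qed
qed

section \<open>The entropy bound for regular graphs\<close>

text \<open>
  Jensen's inequality in the form \<open>ln x \<le> x - 1\<close>, applied once with the uniform distribution on the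
  admissible values at \<open>v\<close> and once with the weights \<open>card (K g) ^ card P\<close> on the colourings of \<open>P\<close>.
  The sum on the right counts the homomorphisms from the complete bipartite graph with both sides of
  size \<open>card P\<close>.
\<close>

lemma sum_ln_inv_cond_prob_le:
  fixes E :: "('a \<times> 'a) set" and R :: "('b \<times> 'b) set" and K :: "('a \<Rightarrow> 'b) \<Rightarrow> 'b set"
  assumes fin: "finite C" and dist: "distinct xs" and v: "v \<in> set xs"
    and F: "F = {f \<in> set xs \<rightarrow>\<^sub>E C. \<forall>(u, v)\<in>E. (f u, f v) \<in> R}" "F \<noteq> {}"
    and P: "P = {u \<in> preds xs v. (u, v) \<in> E}"
    and K: "K = (\<lambda>g. {x \<in> C. \<forall>u\<in>P. (g u, x) \<in> R})"
  shows "(\<Sum>f\<in>F. (\<Sum>u\<in>P. ln (inv_cond_prob xs F f u)) + real (card P) * ln (inv_cond_prob xs F f v))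
    \<le> real (card F) * ln (\<Sum>g\<in>P \<rightarrow>\<^sub>E C. real (card (K g)) ^ card P)"
proof -
  define r where "r = inv_cond_prob xs F"
  define Z where "Z = (\<Sum>g\<in>P \<rightarrow>\<^sub>E C. real (card (K g)) ^ card P)"
  define N where "N = real (card F)"
  define p where "p = card P"
  define y where "y = (\<lambda>f. (\<Prod>u\<in>P. r f u) * real (card (K f)) ^ p)"
  have finF: "finite F" using fin by (simp add: F(1) finite_PiE)
  have N: "N > 0" using finF F(2) by (auto simp: N_def card_gt_0_iff)
  have PE: "P \<subseteq> set xs" unfolding P using preds_subset[of xs v] by auto
  have r: "r f u > 0" if "f \<in> F" for f u using inv_cond_prob_pos[OF finF that] by (simp add: r_def)
  have valC: "f u \<in> C" if "f \<in> F" "u \<in> set xs" for f u using that by (auto simp: F)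
  have fvK: "f v \<in> K f" if "f \<in> F" for f
    using that valC[OF that v] by (auto simp: F K P)
  have finK: "finite (K f)" for f using fin by (auto simp: K)
  have a: "real (card (K f)) > 0" if "f \<in> F" for f
    using fvK[OF that] finK[of f] by (auto simp: card_gt_0_iff)
  have y: "y f > 0" if "f \<in> F" for f
    unfolding y_def using r[OF that] a[OF that] by (intro mult_pos_pos prod_pos zero_less_power) auto
  \<comment> \<open>\<open>K f\<close> depends only on the values on \<open>P\<close>, so the power
    of its size may serve as the weight of a restriction to \<open>P\<close>.\<close>
  have Kres: "K (restrict f P) = K f" for f :: "'a \<Rightarrow> 'b" by (auto simp: K)
  have sum_y: "(\<Sum>f\<in>F. y f) \<le> N * Z"
  proof -
    have "(\<Sum>f\<in>F. (\<Prod>u\<in>P. r f u) * real (card (K (restrict f P))) ^ p) \<le> N * Z"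
      unfolding r_def N_def Z_def p_def
      by (rule sum_prod_inv_cond_prob_le) (use finF fin valC dist PE in auto)
    then show ?thesis by (simp add: y_def Kres)
  qed
  have "(\<Sum>f\<in>F. y f) > 0" using finF F(2) y by (intro sum_pos) auto
  then have Z: "Z > 0" using sum_y N
    by (meson order_less_le_trans zero_less_mult_pos)
  have sum_r: "(\<Sum>f\<in>F. r f v / real (card (K f))) \<le> N"
    unfolding r_def N_def
  proof (rule sum_inv_cond_prob_le)
    fix f g :: "'a \<Rightarrow> 'b" assume "\<And>u. u \<in> preds xs v \<Longrightarrow> f u = g u"
    then have "f u = g u" if "u \<in> P" for u using that by (auto simp: P)
    then show "K f = K g" by (simp add: K)
  qed (use finF fin valC v fvK finK in auto)
  \<comment> \<open>The terms \<open>p * ln (card (K f))\<close> of the two inequalities cancel.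
    What remains besides \<open>ln Z\<close> are error terms whose averages over \<open>F\<close>
    are at most 0 by \<open>sum_y\<close> and \<open>sum_r\<close>.\<close>
  have "(\<Sum>u\<in>P. ln (r f u)) + real p * ln (r f v)
    \<le> ln Z + (y f / Z - 1) + real p * (r f v / real (card (K f)) - 1)" if f: "f \<in> F" for f
  proof -
    have "ln (r f v / real (card (K f))) \<le> r f v / real (card (K f)) - 1"
      using r[OF f] a[OF f] by (intro ln_le_minus_one) auto
    then have "ln (r f v) \<le> ln (real (card (K f))) + (r f v / real (card (K f)) - 1)"
      using r[OF f, of v] a[OF f] by (simp add: ln_div)
    then have 1: "real p * ln (r f v) \<le> real p * (ln (real (card (K f))) + (r f v / real (card (K f)) - 1))"
      by (intro mult_left_mono) auto
    have "ln (y f / Z) \<le> y f / Z - 1" using y[OF f] Z by (intro ln_le_minus_one) auto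
    then have 2: "ln (y f) \<le> ln Z + (y f / Z - 1)" using y[OF f] Z by (simp add: ln_div)
    have "ln (y f) = ln (\<Prod>u\<in>P. r f u) + real p * ln (real (card (K f)))"
      unfolding y_def using r[OF f] a[OF f] 
      by (subst ln_mult_pos) (auto intro!: prod_pos simp: ln_realpow)
    also have "ln (\<Prod>u\<in>P. r f u) = (\<Sum>u\<in>P. ln (r f u))"
      using r[OF f] PE by (intro ln_prod) (auto simp: less_imp_neq[symmetric] intro: finite_subset)
    finally show ?thesis using 1 2 by (simp add: algebra_simps)
  qed
  then have "(\<Sum>f\<in>F. (\<Sum>u\<in>P. ln (r f u)) + real p * ln (r f v))
    \<le> (\<Sum>f\<in>F. ln Z + (y f / Z - 1) + real p * (r f v / real (card (K f)) - 1))"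
    by (rule sum_mono)
  also have "\<dots> = N * ln Z + ((\<Sum>f\<in>F. y f) / Z - N) + real p * ((\<Sum>f\<in>F. r f v / real (card (K f))) - N)"
    by (simp add: sum.distrib sum_subtractf sum_divide_distrib N_def flip: sum_distrib_left)
  also have "\<dots> \<le> N * ln Z + 0 + real p * 0"
    using sum_y sum_r Z N by (intro add_mono mult_left_mono) (auto simp: field_simps)
  finally show ?thesis by (simp add: r_def p_def N_def Z_def)
qed

text \<open>For every \<open>f\<close>, \<open>ln (card F)\<close> is the sum of the logarithms of
  the reciprocals. Of the \<open>d\<close> copies of the term at \<open>v\<close>, one goes to each
  later neighbour and the others stay at \<open>v\<close>; regrouping gives at each vertex the sum
  bounded by the preceding lemma. The second claim counts every edge once, at its later end.\<close>

lemma regular_hom_count_bound: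
  fixes E :: "('a \<times> 'a) set" and R :: "('b \<times> 'b) set"
  assumes fin: "finite C" and dist: "distinct xs"
    and E: "sym E" "irrefl E" "E \<subseteq> set xs \<times> set xs"
    and deg: "\<And>v. v \<in> set xs \<Longrightarrow> card {u. (u, v) \<in> E} = d"
    and F: "F = {f \<in> set xs \<rightarrow>\<^sub>E C. \<forall>(u, v)\<in>E. (f u, f v) \<in> R}" "F \<noteq> {}"
    and P: "P = (\<lambda>v. {u \<in> preds xs v. (u, v) \<in> E})"
  shows "real d * ln (real (card F))
    \<le> (\<Sum>v\<in>set xs. ln (\<Sum>g\<in>P v \<rightarrow>\<^sub>E C.
          real (card {x \<in> C. \<forall>u\<in>P v. (g u, x) \<in> R}) ^ card (P v)))"
    and "2 * (\<Sum>v\<in>set xs. card (P v)) = d * length xs"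
proof -
  define S where "S = (\<lambda>v. {w \<in> set xs. v \<in> P w})"
  define r where "r = inv_cond_prob xs F"
  have finF: "finite F" using fin by (simp add: F(1) finite_PiE)
  have r: "r f u > 0" if "f \<in> F" for f u using inv_cond_prob_pos[OF finF that] by (simp add: r_def)
  have [simp]: "finite (P v)" for v unfolding P by simp
  have [simp]: "finite (S v)" for v unfolding S_def by simp
  have PE: "P v \<subseteq> set xs" for v unfolding P using preds_subset[of xs v] by auto
  have PS: "card (P v) + card (S v) = d" if v: "v \<in> set xs" for v
  proof -
    have "{u. (u, v) \<in> E} = P v \<union> S v"
      using E v preds_total[of _ xs v] preds_subset[of xs]
      by (auto simp: P S_def irrefl_def dest: symD)
    moreover have "P v \<inter> S v = {}"
      using E v preds_total[of _ xs v] preds_subset[of xs v] by (auto simp: P S_def irrefl_def)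
    ultimately show ?thesis using deg[OF v] by (simp add: card_Un_disjoint)
  qed
  \<comment> \<open>Stated for a general monoid, since it serves both the counts in
    \<open>nat\<close> and the real logarithms.\<close>
  have swap: "(\<Sum>v\<in>set xs. \<Sum>w\<in>S v. h v) = (\<Sum>w\<in>set xs. \<Sum>v\<in>P w. h v)" for h :: "'a \<Rightarrow> 'c :: comm_monoid_add"
  proof -
    have "(\<Sum>v\<in>set xs. \<Sum>w\<in>S v. h v) = (\<Sum>w\<in>set xs. \<Sum>v | v \<in> set xs \<and> v \<in> P w. h v)"
      unfolding S_def by (rule sum.swap_restrict) auto
    also have "\<dots> = (\<Sum>w\<in>set xs. \<Sum>v\<in>P w. h v)"
      using PE by (intro sum.cong) auto
    finally show ?thesis .
  qed
  have "(\<Sum>v\<in>set xs. card (S v)) = (\<Sum>w\<in>set xs. card (P w))"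
    using swap[of "\<lambda>_. 1::nat"] by simp
  then have "2 * (\<Sum>v\<in>set xs. card (P v)) = (\<Sum>v\<in>set xs. card (P v) + card (S v))"
    by (simp add: sum.distrib)
  then show "2 * (\<Sum>v\<in>set xs. card (P v)) = d * length xs"
    using PS dist by (simp add: distinct_card)

  have entropy: "real d * ln (real (card F))
    = (\<Sum>v\<in>set xs. (\<Sum>u\<in>P v. ln (r f u)) + real (card (P v)) * ln (r f v))" if f: "f \<in> F" for f
  proof -
    \<comment> \<open>Once all values on \<open>xs\<close> are revealed, extensionality leaves only
      \<open>f\<close>, so the product of the reciprocals is exactly \<open>card F\<close>.\<close>
    have "g = f" if "g \<in> F" "\<forall>u\<in>set xs. g u = f u" for g
      using that f by (intro PiE_ext[where k = "set xs" and s = "\<lambda>_. C"]) (auto simp: F)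
    then have single: "{g \<in> F. \<forall>u\<in>set xs. g u = f u} = {f}" using f by blast
    have "(\<Prod>v\<in>set xs. r f v) = real (card F)"
      using prod_inv_cond_prob[OF finF f dist] unfolding r_def single by simp
    moreover have "ln (\<Prod>v\<in>set xs. r f v) = (\<Sum>v\<in>set xs. ln (r f v))"
      using r[OF f] by (intro ln_prod) (auto simp: less_imp_neq[symmetric])
    ultimately have "real d * ln (real (card F)) = (\<Sum>v\<in>set xs. real d * ln (r f v))"
      by (simp add: sum_distrib_left)
    also have "\<dots> = (\<Sum>v\<in>set xs. (\<Sum>w\<in>S v. ln (r f v)) + real (card (P v)) * ln (r f v))"
      using PS by (intro sum.cong) (auto simp: distrib_right simp flip: PS)
    also have "\<dots> = (\<Sum>v\<in>set xs. (\<Sum>u\<in>P v. ln (r f u)) + real (card (P v)) * ln (r f v))"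
      unfolding sum.distrib swap ..
    finally show ?thesis .
  qed
  define Z where "Z = (\<lambda>v. \<Sum>g\<in>P v \<rightarrow>\<^sub>E C.
          real (card {x \<in> C. \<forall>u\<in>P v. (g u, x) \<in> R}) ^ card (P v))"
  have "real (card F) * (real d * ln (real (card F)))
    = (\<Sum>f\<in>F. \<Sum>v\<in>set xs. (\<Sum>u\<in>P v. ln (r f u)) + real (card (P v)) * ln (r f v))"
    by (simp add: sum.cong[OF refl entropy[symmetric]])
  also have "\<dots> = (\<Sum>v\<in>set xs. \<Sum>f\<in>F. (\<Sum>u\<in>P v. ln (r f u)) + real (card (P v)) * ln (r f v))"
    by (rule sum.swap)
  also have "\<dots> \<le> (\<Sum>v\<in>set xs. real (card F) * ln (Z v))"
    unfolding r_def Z_def using F P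
    by (intro sum_mono sum_ln_inv_cond_prob_le[OF fin dist, where E = E]) auto
  also have "\<dots> = real (card F) * (\<Sum>v\<in>set xs. ln (Z v))" by (simp add: sum_distrib_left)
  finally show "real d * ln (real (card F)) \<le> (\<Sum>v\<in>set xs. ln (Z v))"
    using finF F(2) by (simp add: card_gt_0_iff)
qed

section \<open>Averaging over vertex orders\<close>

text \<open>
  The right-hand side is the expectation of the left-hand side for a uniformly random order, in which
  \<open>v\<close> has each possible rank among its neighbours with equal probability. The induction picks the last
  vertex by averaging.
\<close>

lemma exists_order_sum_power_le:
  fixes h :: "'a \<Rightarrow> real" and E :: "('a \<times> 'a) set"
  assumes "finite W" "irrefl E"
  shows "\<exists>ys. distinct ys \<and> set ys = W \<and>
    (\<Sum>v\<in>W. h v * x ^ card {u \<in> preds ys v. (u, v) \<in> E})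
    \<le> (\<Sum>v\<in>W. h v * ((\<Sum>j\<le>card {u \<in> W. (u, v) \<in> E}. x ^ j) / (real (card {u \<in> W. (u, v) \<in> E}) + 1)))"
  using assms(1)
proof (induction "card W" arbitrary: W)
  case 0
  then show ?case by simp
next
  case (Suc k)
  define D where "D = (\<lambda>W v. card {u \<in> W. (u, v) \<in> E})"
  \<comment> \<open>\<open>G W v\<close> is the mean of the power when the rank of \<open>v\<close>
    among its neighbours in \<open>W\<close> is uniform; \<open>T v\<close> is the mean of the
    weighted total given that \<open>v\<close> comes last.\<close>
  define G where "G = (\<lambda>W v. (\<Sum>j\<le>D W v. x ^ j) / (real (D W v) + 1))"
  define T where "T = (\<lambda>v. h v * x ^ D W v + (\<Sum>u\<in>W - {v}. h u * G (W - {v}) u))"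
  define S where "S = (\<Sum>v\<in>W. h v * G W v)"
  note finW = \<open>finite W\<close>
  have irr: "(u, u) \<notin> E" for u using assms(2) by (auto simp: irrefl_def)
  \<comment> \<open>Condition on the last vertex: it is \<open>u\<close> itself, or a neighbour of
    \<open>u\<close>, which lowers the degree by one, or a non-neighbour, which changes
    nothing.\<close>
  have key: "x ^ D W u + (\<Sum>v\<in>W - {u}. G (W - {v}) u) = real (card W) * G W u" if u: "u \<in> W" for u
  proof -
    define t where "t = D W u"
    define A where "A = {v \<in> W. (v, u) \<in> E}"
    define B where "B = W - {u} - A"
    have A: "card A = t" "finite A" "A \<subseteq> W - {u}" "W - {u} = A \<union> B" "A \<inter> B = {}" "finite B"
      using finW irr by (auto simp: A_def t_def D_def B_def)
    have "card W = Suc (card (W - {u}))" by (rule card.remove[OF finW u])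
    also have "card (W - {u}) = card A + card B" unfolding A(4) using A by (intro card_Un_disjoint) auto
    finally have cW: "card W = Suc (t + card B)" using A by simp
    have "D (W - {v}) u = t - 1" if "v \<in> A" for v
    proof -
      have "{w \<in> W - {v}. (w, u) \<in> E} = A - {v}" by (auto simp: A_def)
      then show ?thesis using that A by (simp add: D_def)
    qed
    then have "(\<Sum>v\<in>A. G (W - {v}) u) = (\<Sum>v\<in>A. (\<Sum>j\<le>t - 1. x ^ j) / (real (t - 1) + 1))"
      by (simp add: G_def)
    \<comment> \<open>For \<open>t = 0\<close> the subtraction truncates, but then \<open>A\<close>
      is empty and both sides are 0.\<close>
    also have "\<dots> = (\<Sum>j<t. x ^ j)"
      using A by (cases t) (auto simp: lessThan_Suc_atMost add_nonneg_eq_0_iff add.commute)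
    finally have 1: "(\<Sum>v\<in>A. G (W - {v}) u) = (\<Sum>j<t. x ^ j)" .
    have "D (W - {v}) u = t" if "v \<in> B" for v
    proof -
      have "{w \<in> W - {v}. (w, u) \<in> E} = A" using that by (auto simp: A_def B_def)
      then show ?thesis using A by (simp add: D_def)
    qed
    then have 2: "(\<Sum>v\<in>B. G (W - {v}) u) = real (card B) * G W u"
      by (simp add: G_def t_def)
    have "x ^ t + (\<Sum>j<t. x ^ j) = (\<Sum>j\<le>t. x ^ j)" by (simp add: lessThan_Suc_atMost[symmetric])
    also have "\<dots> = (real t + 1) * G W u" unfolding G_def t_def[symmetric] by (simp add: add_nonneg_eq_0_iff)
    finally have 3: "x ^ t + (\<Sum>j<t. x ^ j) = (real t + 1) * G W u" .
    have "(\<Sum>v\<in>W - {u}. G (W - {v}) u) = (\<Sum>j<t. x ^ j) + real (card B) * G W u"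
      unfolding A(4) using A 1 2 by (simp add: sum.union_disjoint)
    then show ?thesis using 3 cW unfolding t_def[symmetric] by (simp add: algebra_simps)
  qed
  have "(\<Sum>v\<in>W. \<Sum>u\<in>W - {v}. h u * G (W - {v}) u) = (\<Sum>u\<in>W. \<Sum>v\<in>W - {u}. h u * G (W - {v}) u)"
  proof -
    have W: "W - {v} = {u \<in> W. u \<noteq> v}" "W - {v} = {u \<in> W. v \<noteq> u}" for v by auto
    show ?thesis
      by (subst W(1), subst sum.swap_restrict[OF finW finW]) (simp add: W(2))
  qed
  then have "(\<Sum>v\<in>W. T v) = (\<Sum>u\<in>W. h u * (x ^ D W u + (\<Sum>v\<in>W - {u}. G (W - {v}) u)))"
    by (simp add: T_def sum.distrib distrib_left sum_distrib_left)
  also have "\<dots> = real (card W) * S" using key by (simp add: S_def sum_distrib_left mult_ac)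
  finally have sumT: "(\<Sum>v\<in>W. T v) = real (card W) * S" .
  \<comment> \<open>The average of \<open>T\<close> over \<open>W\<close> is \<open>S\<close>, so
    some choice of the last vertex is no worse than average.\<close>
  have "\<exists>v\<in>W. T v \<le> S"
  proof (rule ccontr)
    assume "\<not> ?thesis"
    moreover have "W \<noteq> {}" using Suc.hyps(2) by auto
    ultimately have "(\<Sum>v\<in>W. S) < (\<Sum>v\<in>W. T v)" using finW by (intro sum_strict_mono) auto
    then show False using sumT by simp
  qed
  then obtain v where v: "v \<in> W" "T v \<le> S" by blast
  have "k = card (W - {v})" using Suc.hyps(2) v finW by simp
  from Suc.hyps(1)[OF this] obtain ys where ys: "distinct ys" "set ys = W - {v}"
    "(\<Sum>u\<in>W - {v}. h u * x ^ card {w \<in> preds ys u. (w, u) \<in> E}) \<le> (\<Sum>u\<in>W - {v}. h u * G (W - {v}) u)"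
    using finW unfolding G_def D_def by auto
  have "(\<Sum>u\<in>W. h u * x ^ card {w \<in> preds (ys @ [v]) u. (w, u) \<in> E})
    = h v * x ^ card {w \<in> preds (ys @ [v]) v. (w, v) \<in> E}
      + (\<Sum>u\<in>W - {v}. h u * x ^ card {w \<in> preds (ys @ [v]) u. (w, u) \<in> E})"
    using v finW by (simp add: sum.remove)
  also have "{w \<in> preds (ys @ [v]) v. (w, v) \<in> E} = {w \<in> W. (w, v) \<in> E}"
    using ys irr by (auto simp: preds_append preds_Cons)
  also have "(\<Sum>u\<in>W - {v}. h u * x ^ card {w \<in> preds (ys @ [v]) u. (w, u) \<in> E})
    = (\<Sum>u\<in>W - {v}. h u * x ^ card {w \<in> preds ys u. (w, u) \<in> E})"
    using ys by (intro sum.cong) (auto simp: preds_append)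
  also have "h v * x ^ card {w \<in> W. (w, v) \<in> E} + \<dots> \<le> T v"
    using ys(3) unfolding T_def D_def by simp
  also note v(2)
  finally have "(\<Sum>u\<in>W. h u * x ^ card {w \<in> preds (ys @ [v]) u. (w, u) \<in> E}) \<le> S" .
  then show ?case using ys v unfolding S_def G_def D_def
    by (intro exI[of _ "ys @ [v]"]) auto
qed

section \<open>Widom-Rowlinson colourings of complete bipartite graphs\<close>

text \<open>Classify \<open>g\<close> by its use of 0 and 2. If both occur, 1 is the only common
  neighbour, and there are at most \<open>3 ^ p\<close> such \<open>g\<close>. If just one occurs,
  there are at most two common neighbours and \<open>g\<close> maps into a set of two colours, which
  costs \<open>2 ^ p * 2 ^ p\<close> in each of the two cases. If neither occurs, \<open>g\<close>
  is constantly 1 and costs \<open>3 ^ p\<close>.\<close>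

lemma sum_common_neighbours_H_WR_le:
  assumes "finite P"
  shows "(\<Sum>g\<in>P \<rightarrow>\<^sub>E {0, 1, 2}.
      real (card {x \<in> {0, 1, 2}. \<forall>u\<in>P. (g u, x) \<in> parcs H_WR}) ^ card P)
    \<le> 2 * 4 ^ card P + 2 * 3 ^ card P"
proof -
  define p where "p = card P"
  define K where "K = (\<lambda>g. {x \<in> {0, 1, 2 :: nat}. \<forall>u\<in>P. (g u, x) \<in> parcs H_WR})"
  define A where "A = P \<rightarrow>\<^sub>E {0, 1, 2 :: nat}"
  have finA: "finite A" using assms by (simp add: A_def finite_PiE)
  have cardE: "card (P \<rightarrow>\<^sub>E B) = card B ^ p" for B :: "nat set"
    using assms by (simp add: card_PiE p_def)
  let ?b = "\<lambda>g B c. if g \<in> P \<rightarrow>\<^sub>E B then c else (0::real)"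
  \<comment> \<open>The indicators may overlap: all terms are nonnegative, so it suffices that one
    of them covers each \<open>g\<close>. The 1 covers the colourings that use both 0 and 2.\<close>
  have pt: "real (card (K g)) ^ p \<le> 1 + ?b g {0, 1} (2 ^ p) + ?b g {1, 2} (2 ^ p) + ?b g {1} (3 ^ p)"
    if g: "g \<in> A" for g
  proof -
    have le: "real (card (K g)) ^ p \<le> real (card B) ^ p" if "K g \<subseteq> B" "finite B" for B
      using that by (intro power_mono) (auto intro: card_mono)
    have nn: "0 \<le> ?b g B (2 ^ p)" "0 \<le> ?b g B (3 ^ p)" for B by simp_all
    have gP: "g u \<in> {0, 1, 2}" if "u \<in> P" for u
      using PiE_mem[of g P "\<lambda>_. {0, 1, 2}" u] g that by (simp add: A_def)
    have gx: "g u = undefined" if "u \<notin> P" for u using g that by (auto simp: A_def)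
    consider "\<exists>u\<in>P. g u = 0" "\<exists>u\<in>P. g u = 2" | "\<exists>u\<in>P. g u = 0" "\<forall>u\<in>P. g u \<noteq> 2"
      | "\<forall>u\<in>P. g u \<noteq> 0" "\<exists>u\<in>P. g u = 2" | "\<forall>u\<in>P. g u \<noteq> 0 \<and> g u \<noteq> 2"
      by metis
    then show ?thesis
    proof cases
      case 1
      then have "K g \<subseteq> {1}" by (auto simp: K_def H_WR_def)
      then have "real (card (K g)) ^ p \<le> 1" using le[of "{1}"] by simp
      then show ?thesis using nn(1)[of "{0, 1}"] nn(1)[of "{1, 2}"] nn(2)[of "{1}"]
        by linarith
    next
      case 2
      then have "K g \<subseteq> {0, 1}" by (auto simp: K_def H_WR_def)
      then have "real (card (K g)) ^ p \<le> 2 ^ p" using le[of "{0, 1}"] by simp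
      moreover have "g \<in> P \<rightarrow>\<^sub>E {0, 1}" using 2 gP gx by (intro PiE_I) force+
      then have "?b g {0, 1} (2 ^ p) = 2 ^ p" by simp
      ultimately show ?thesis using nn(1)[of "{1, 2}"] nn(2)[of "{1}"] by linarith
    next
      case 3
      then have "K g \<subseteq> {1, 2}" by (auto simp: K_def H_WR_def)
      then have "real (card (K g)) ^ p \<le> 2 ^ p" using le[of "{1, 2}"] by simp
      moreover have "g \<in> P \<rightarrow>\<^sub>E {1, 2}" using 3 gP gx by (intro PiE_I) force+
      then have "?b g {1, 2} (2 ^ p) = 2 ^ p" by simp
      ultimately show ?thesis using nn(1)[of "{0, 1}"] nn(2)[of "{1}"] by linarith
    next
      case 4
      have "g \<in> P \<rightarrow>\<^sub>E {1}" using 4 gP gx by (intro PiE_I) force+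
      then have "?b g {1} (3 ^ p) = 3 ^ p" by simp
      moreover have "K g \<subseteq> {0, 1, 2}" by (auto simp: K_def)
      then have "real (card (K g)) ^ p \<le> 3 ^ p" using le[of "{0, 1, 2}"] by simp
      ultimately show ?thesis using nn(1)[of "{0, 1}"] nn(1)[of "{1, 2}"] by linarith
    qed
  qed
  have b: "(\<Sum>g\<in>A. ?b g B c) = real (card B ^ p) * c" if "B \<subseteq> {0, 1, 2}" for B c
  proof -
    have "P \<rightarrow>\<^sub>E B \<subseteq> A" using that by (auto simp: A_def PiE_iff)
    then have "(\<Sum>g\<in>A. ?b g B c) = (\<Sum>g\<in>P \<rightarrow>\<^sub>E B. c)"
      using finA by (intro sum.mono_neutral_cong_right) auto
    then show ?thesis by (simp add: cardE)
  qed
  have b1: "(\<Sum>g\<in>A. ?b g {0, 1} (2 ^ p)) = 2 ^ p * 2 ^ p" using b[of "{0, 1}"] by simp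
  have b2: "(\<Sum>g\<in>A. ?b g {1, 2} (2 ^ p)) = 2 ^ p * 2 ^ p" using b[of "{1, 2}"] by simp
  have b3: "(\<Sum>g\<in>A. ?b g {1} (3 ^ p)) = 3 ^ p" using b[of "{1}"] by simp
  have "(\<Sum>g\<in>A. real (card (K g)) ^ p)
    \<le> (\<Sum>g\<in>A. 1 + ?b g {0, 1} (2 ^ p) + ?b g {1, 2} (2 ^ p) + ?b g {1} (3 ^ p))"
    using pt by (rule sum_mono)
  also have "\<dots> = real (card A) + 2 * (2 ^ p * 2 ^ p) + 3 ^ p"
    unfolding sum.distrib b1 b2 b3 by simp
  also have "real (card A) = 3 ^ p" by (simp add: A_def cardE card_insert_if)
  also have "(2::real) ^ p * 2 ^ p = 4 ^ p" by (simp flip: power_mult_distrib)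
  finally show ?thesis by (simp add: A_def K_def p_def)
qed

text \<open>Factor out the main term \<open>2 * 4 ^ p\<close> and apply ln (1 + x) \<le> x to the
  rest.\<close>

lemma ln_sum_common_neighbours_H_WR_le:
  assumes "finite P"
  shows "ln (\<Sum>g\<in>P \<rightarrow>\<^sub>E {0, 1, 2}.
      real (card {x \<in> {0, 1, 2}. \<forall>u\<in>P. (g u, x) \<in> parcs H_WR}) ^ card P)
    \<le> (2 * real (card P) + 1) * ln 2 + (3 / 4) ^ card P"
  (is "ln ?Z \<le> _")
proof -
  define p where "p = card P"
  have "?Z > 0"
  proof (rule sum_pos2)
    \<comment> \<open>Colour 1 is adjacent to every colour, so this colouring yields a positive
      term.\<close>
    let ?g = "\<lambda>u\<in>P. 1::nat"
    show "finite (P \<rightarrow>\<^sub>E {0, 1, 2 :: nat})" using assms by (simp add: finite_PiE)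
    show "?g \<in> P \<rightarrow>\<^sub>E {0, 1, 2}" by auto
    have "1 \<in> {x \<in> {0, 1, 2}. \<forall>u\<in>P. (?g u, x) \<in> parcs H_WR}" by (auto simp: H_WR_def)
    then have "card {x \<in> {0, 1, 2}. \<forall>u\<in>P. (?g u, x) \<in> parcs H_WR} > 0"
      unfolding card_gt_0_iff by fastforce
    then show "real (card {x \<in> {0, 1, 2}. \<forall>u\<in>P. (?g u, x) \<in> parcs H_WR}) ^ card P > 0" by simp
  qed auto
  moreover have "?Z \<le> 2 * 4 ^ p + 2 * 3 ^ p"
    using sum_common_neighbours_H_WR_le[OF assms] by (simp add: p_def)
  ultimately have "ln ?Z \<le> ln (2 * 4 ^ p + 2 * 3 ^ p)" by simp
  also have "(2 * 4 ^ p + 2 * 3 ^ p :: real) = 2 * 4 ^ p * (1 + (3 / 4) ^ p)"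
    by (simp add: field_simps)
  also have "ln \<dots> = ln (2 * 4 ^ p) + ln (1 + (3 / 4) ^ p)"
    by (intro ln_mult_pos) (auto intro: add_pos_pos)
  also have "(2 * 4 ^ p :: real) = 2 ^ (2 * p + 1)" by (simp add: power_mult)
  also have "ln (2 ^ (2 * p + 1) :: real) = (2 * real p + 1) * ln 2" by (subst ln_realpow) (auto simp: algebra_simps)
  also have "ln (1 + (3 / 4 :: real) ^ p) \<le> (3 / 4) ^ p" by (rule ln_add_one_self_le_self) simp
  finally show ?thesis by (simp add: p_def)
qed

section \<open>The bound with the independent set first\<close>

lemma sum_three_quarters: "(\<Sum>j\<le>t. (3 / 4 :: real) ^ j) = 4 - 3 * (3 / 4) ^ t"
  by (induction t) auto

text \<open>For a vertex with \<open>k\<close> of its \<open>d\<close> neighbours in the independent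
  set, the left side is the mean of \<open>(3 / 4) ^ p\<close> over the orders. Both
  \<open>(k + 1) * (3 / 4) ^ k\<close> and the geometric sum are at most 4, and \<open>d + 1\<close>
  is at most \<open>(d - k + 1) * (k + 1)\<close>.\<close>

lemma three_quarters_weight_le:
  assumes "k \<le> d"
  shows "(3 / 4) ^ k * ((\<Sum>j\<le>d - k. (3 / 4 :: real) ^ j) / (real (d - k) + 1)) \<le> 16 / (real d + 1)"
proof -
  define m where "m = real (d - k) + 1"
  have m: "m \<ge> 1" "real d + 1 = m + real k" using assms by (auto simp: m_def)
  have "(real k + 1) * (3 / 4) ^ k = (\<Sum>j\<le>k. (3 / 4 :: real) ^ k)" by simp
  also have "\<dots> \<le> (\<Sum>j\<le>k. (3 / 4 :: real) ^ j)" by (intro sum_mono power_decreasing) auto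
  also have "\<dots> \<le> 4" by (simp add: sum_three_quarters)
  finally have 1: "(real k + 1) * (3 / 4 :: real) ^ k \<le> 4" .
  have "real d + 1 \<le> m * (real k + 1)" using m mult_right_mono[of 1 m "real k"] by (simp add: algebra_simps)
  then have "(real d + 1) * (3 / 4) ^ k \<le> m * (real k + 1) * (3 / 4) ^ k"
    by (intro mult_right_mono) auto
  also have "\<dots> \<le> m * 4" using 1 m unfolding mult.assoc by (intro mult_left_mono) auto
  finally have 2: "(3 / 4) ^ k / m \<le> 4 / (real d + 1)" using m(1) by (simp add: field_simps)
  have "(\<Sum>j\<le>d - k. (3 / 4 :: real) ^ j) \<le> 4" by (simp add: sum_three_quarters)
  then have "(3 / 4) ^ k / m * (\<Sum>j\<le>d - k. (3 / 4 :: real) ^ j) \<le> 4 / (real d + 1) * 4"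
    using 2 by (intro mult_mono) (auto intro: sum_nonneg)
  then show ?thesis by (simp add: m_def)
qed

text \<open>The first term comes from \<open>2 * card (P v)\<close> summed over all vertices. Only
  the vertices outside \<open>I\<close> pay a further \<open>ln 2\<close>, and the last term bounds
  the sum of their excesses \<open>(3 / 4) ^ card (P v)\<close>.\<close>

lemma regular_WR_count_bound:
  fixes E :: "('a \<times> 'a) set"
  assumes fin: "finite V" and E: "sym E" "irrefl E" "E \<subseteq> V \<times> V"
    and deg: "\<And>v. v \<in> V \<Longrightarrow> card {u. (u, v) \<in> E} = d"
    and I: "I \<subseteq> V" "\<And>u v. u \<in> I \<Longrightarrow> v \<in> I \<Longrightarrow> (u, v) \<notin> E"
    and F: "F = {f \<in> V \<rightarrow>\<^sub>E {0, 1, 2}. \<forall>(u, v)\<in>E. (f u, f v) \<in> parcs H_WR}"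
  shows "F \<noteq> {}" and "real d * ln (real (card F))
    \<le> real (card V) * real d * ln 2 + (real (card V) - real (card I)) * ln 2
      + 16 * real (card V) / (real d + 1)"
proof -
  define W where "W = V - I"
  define k where "k = (\<lambda>v. card {u \<in> I. (u, v) \<in> E})"
  have finW: "finite W" and finI: "finite I" using fin I by (auto simp: W_def intro: finite_subset)
  have degW: "card {u \<in> W. (u, v) \<in> E} = d - k v" "k v \<le> d" if "v \<in> W" for v
  proof -
    have v: "v \<in> V" using that by (simp add: W_def)
    have "{u. (u, v) \<in> E} = {u \<in> I. (u, v) \<in> E} \<union> {u \<in> W. (u, v) \<in> E}"
      using E by (auto simp: W_def)
    then have "d = card ({u \<in> I. (u, v) \<in> E} \<union> {u \<in> W. (u, v) \<in> E})"
      using deg[OF v] by (simp only:)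
    also have "\<dots> = k v + card {u \<in> W. (u, v) \<in> E}"
      unfolding k_def using finW finI by (intro card_Un_disjoint) (auto simp: W_def)
    finally have "d = k v + card {u \<in> W. (u, v) \<in> E}" .
    then show "card {u \<in> W. (u, v) \<in> E} = d - k v" "k v \<le> d" by linarith+
  qed
  \<comment> \<open>The weight \<open>(3 / 4) ^ k v\<close> accounts for the neighbours in
    \<open>I\<close>, all of which will precede \<open>v\<close>.\<close>
  obtain ys where ys: "distinct ys" "set ys = W"
    and ord: "(\<Sum>v\<in>W. (3 / 4) ^ k v * (3 / 4) ^ card {u \<in> preds ys v. (u, v) \<in> E})
      \<le> (\<Sum>v\<in>W. (3 / 4) ^ k v * ((\<Sum>j\<le>card {u \<in> W. (u, v) \<in> E}. (3 / 4 :: real) ^ j)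
          / (real (card {u \<in> W. (u, v) \<in> E}) + 1)))"
    using exists_order_sum_power_le[OF finW E(2), of "\<lambda>v. (3 / 4) ^ k v" "3 / 4"] by blast
  obtain zs where zs: "distinct zs" "set zs = I" using finite_distinct_list[OF finI] by blast
  define xs where "xs = zs @ ys"
  have xs: "distinct xs" "set xs = V" using ys zs I by (auto simp: xs_def W_def)
  define P where "P = (\<lambda>v. {u \<in> preds xs v. (u, v) \<in> E})"
  have PI: "P v = {}" if "v \<in> I" for v
    using that I(2) zs preds_subset[of zs v] by (auto simp: P_def xs_def preds_append)
  have PW: "card (P v) = k v + card {u \<in> preds ys v. (u, v) \<in> E}" if "v \<in> W" for v
  proof -
    have "P v = {u \<in> I. (u, v) \<in> E} \<union> {u \<in> preds ys v. (u, v) \<in> E}"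
      using that zs by (auto simp: P_def xs_def preds_append W_def)
    moreover have "{u \<in> I. (u, v) \<in> E} \<inter> {u \<in> preds ys v. (u, v) \<in> E} = {}"
      using preds_subset[of ys v] ys by (auto simp: W_def)
    ultimately show ?thesis using finI unfolding k_def by (simp add: card_Un_disjoint)
  qed
  have "(\<lambda>u\<in>V. 1) \<in> F" using E(3) by (auto simp: F H_WR_def)
  then show F0: "F \<noteq> {}" by auto
  define Z where "Z = (\<lambda>v. \<Sum>g\<in>P v \<rightarrow>\<^sub>E {0, 1, 2}.
      real (card {x \<in> {0, 1, 2}. \<forall>u\<in>P v. (g u, x) \<in> parcs H_WR}) ^ card (P v))"
  have main: "real d * ln (real (card F)) \<le> (\<Sum>v\<in>V. ln (Z v))"
    "2 * (\<Sum>v\<in>V. card (P v)) = d * card V"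
    using regular_hom_count_bound[where xs = xs and C = "{0, 1, 2}" and d = d and E = E
        and R = "parcs H_WR" and F = F and P = P] E F F0 deg xs distinct_card[of xs]
    by (auto simp: P_def Z_def)
  have V: "(\<Sum>v\<in>V. h v) = (\<Sum>v\<in>I. h v) + (\<Sum>v\<in>W. h v)" for h :: "'a \<Rightarrow> real"
    unfolding W_def by (subst add.commute) (rule sum.subset_diff[OF I(1) fin])
  have "(\<Sum>v\<in>V. ln (Z v)) = (\<Sum>v\<in>W. ln (Z v))" unfolding V using PI by (simp add: Z_def)
  \<comment> \<open>For \<open>v\<close> in \<open>I\<close> the set \<open>P v\<close> is empty, so
    \<open>Z v\<close> is a single zeroth power and \<open>ln (Z v) = 0\<close>.\<close>
  also have "\<dots> \<le> (\<Sum>v\<in>W. (2 * real (card (P v)) + 1) * ln 2 + (3 / 4) ^ card (P v))"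
    unfolding Z_def by (intro sum_mono ln_sum_common_neighbours_H_WR_le) (simp add: P_def)
  also have "\<dots> = 2 * (\<Sum>v\<in>W. real (card (P v))) * ln 2 + real (card W) * ln 2
      + (\<Sum>v\<in>W. (3 / 4) ^ card (P v))"
    by (simp add: sum.distrib distrib_right sum_distrib_left sum_distrib_right)
  also have "2 * (\<Sum>v\<in>W. real (card (P v))) = 2 * (\<Sum>v\<in>V. real (card (P v)))"
    unfolding V using PI by simp
  also have "\<dots> = real (2 * (\<Sum>v\<in>V. card (P v)))" by simp
  also have "\<dots> = real (card V) * real d" unfolding main(2) by simp
  also have "real (card W) = real (card V) - real (card I)"
    unfolding W_def using I fin finI by (simp add: card_Diff_subset card_mono)
  also have "(\<Sum>v\<in>W. (3 / 4 :: real) ^ card (P v))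
    = (\<Sum>v\<in>W. (3 / 4) ^ k v * (3 / 4) ^ card {u \<in> preds ys v. (u, v) \<in> E})"
    using PW by (intro sum.cong) (auto simp: power_add)
  also have "\<dots> \<le> (\<Sum>v\<in>W. 16 / (real d + 1))"
  proof (rule order_trans[OF ord], rule sum_mono)
    fix v assume "v \<in> W"
    then show "(3 / 4) ^ k v * ((\<Sum>j\<le>card {u \<in> W. (u, v) \<in> E}. (3 / 4 :: real) ^ j)
          / (real (card {u \<in> W. (u, v) \<in> E}) + 1)) \<le> 16 / (real d + 1)"
      using three_quarters_weight_le[OF degW(2)] by (simp only: degW(1))
  qed
  also have "\<dots> \<le> (\<Sum>v\<in>V. 16 / (real d + 1))"
    using fin by (intro sum_mono2) (auto simp: W_def)
  also have "\<dots> = 16 * real (card V) / (real d + 1)" by simp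
  finally have "(\<Sum>v\<in>V. ln (Z v))
    \<le> real (card V) * real d * ln 2 + (real (card V) - real (card I)) * ln 2
      + 16 * real (card V) / (real d + 1)"
    by simp
  with main(1) show "real d * ln (real (card F))
    \<le> real (card V) * real d * ln 2 + (real (card V) - real (card I)) * ln 2
      + 16 * real (card V) / (real d + 1)"
    by (rule order_trans)
qed

section \<open>Comparison with the complete graph\<close>

text \<open>After multiplication by \<open>d * (d + 1)\<close>, the main terms are
  \<open>n * (d + 1)^2 * ln 2\<close> on the left and \<open>n * d * (d + 2) * ln 2\<close> on the
  right, which differ by only \<open>n * ln 2\<close>. The gain \<open>40 * n * ln 2\<close> from
  the independent set outweighs this and the errors \<open>16 * n\<close> and
  \<open>n\<close>.\<close>

lemma strict_bound_from_independence:
  fixes L M :: real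
  assumes "d > 0" "n > 0"
    and L: "real d * L \<le> real n * real d * ln 2 + (real n - i) * ln 2 + 16 * real n / (real d + 1)"
    and i: "i \<ge> 40 * real n / real d"
    and M: "M \<ge> 2 ^ (d + 2) - 1"
  shows "L < real n / (real d + 1) * ln M"
proof -
  have "2 ^ (d + 2) \<ge> real d + 2"
  proof -
    have "d + 2 < 2 ^ (d + 2)" by (rule less_exp)
    then have "real (d + 2) \<le> real (2 ^ (d + 2))" unfolding of_nat_le_iff by simp
    then show ?thesis by simp
  qed
  then have M1: "M \<ge> real d + 1" "M > 0" using M by linarith+
  have "ln (2 ^ (d + 2) / M) \<le> 2 ^ (d + 2) / M - 1" using M1 by (intro ln_le_minus_one) auto
  also have "\<dots> \<le> (M + 1) / M - 1"
    using M M1 by (intro diff_right_mono divide_right_mono) auto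
  also have "\<dots> = 1 / M" using M1 by (simp add: add_divide_distrib)
  \<comment> \<open>Multiplication by \<open>d\<close> will turn this error into the constant
    1.\<close>
  also have "\<dots> \<le> 1 / real d" using M1 assms by (intro divide_left_mono) auto
  also have "ln (2 ^ (d + 2) / M) = ln (2 ^ (d + 2)) - ln M" using M1 by (intro ln_divide_pos) auto
  also have "ln (2 ^ (d + 2) :: real) = (real d + 2) * ln 2" by (subst ln_realpow) auto
  finally have "(real d + 2) * ln 2 - 1 / real d \<le> ln M" by simp
  then have "real d * ((real d + 2) * ln 2 - 1 / real d) \<le> real d * ln M" by (intro mult_left_mono) auto
  then have lnM: "real d * (real d + 2) * ln 2 - 1 \<le> real d * ln M" using assms by (simp add: algebra_simps)
  define D where "D = real d + 1"
  have D: "D > 0" "real d = D - 1" by (auto simp: D_def)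
  have "i * real d \<ge> 40 * real n" using i assms by (simp add: field_simps)
  moreover have "i \<ge> 0" using i assms by (intro order_trans[OF _ i]) auto
  ultimately have iD: "i * D \<ge> 40 * real n" by (simp add: D_def algebra_simps)
  have "D * (real d * L) \<le> D * (real n * real d * ln 2 + (real n - i) * ln 2 + 16 * real n / D)"
    using L D(1) by (intro mult_left_mono) (simp_all add: D_def)
  also have "\<dots> = real n * real d * D * ln 2 + real n * D * ln 2 - (i * D) * ln 2 + 16 * real n"
    using D by (simp add: field_simps)
  also have "\<dots> \<le> real n * real d * D * ln 2 + real n * D * ln 2 - (40 * real n) * ln 2 + 16 * real n"
    using mult_right_mono[OF iD, of "ln 2"] by simp
  also have "\<dots> = real n * (real d * (real d + 2) * ln 2 - 1) - real n * (39 * ln 2 - 17)"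
    by (simp add: D_def algebra_simps)
  \<comment> \<open>The inequality ln x \<le> x - 1 at 1/2 gives \<open>ln 2 \<ge> 1 / 2\<close>,
    hence \<open>39 * ln 2 > 17\<close>.\<close>
  also have "\<dots> < real n * (real d * (real d + 2) * ln 2 - 1)"
    using ln_le_minus_one[of "1 / 2 :: real"] assms by (simp add: ln_div)
  also have "\<dots> \<le> real n * (real d * ln M)" using lnM by (intro mult_left_mono) auto
  finally have "real d * (D * L) < real d * (real n * ln M)" by (simp add: mult_ac)
  then have "D * L < real n * ln M" using assms by simp
  then show ?thesis using D unfolding D_def[symmetric] by (simp add: field_simps)
qed

text \<open>The colour sets {0, 1} and {1, 2} are cliques with loops, so every map into either is a
  homomorphism. The two families of maps share only the constant map 1.\<close>

lemma hom_count_complete_graph_H_WR_ge: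
  "2 ^ (m + 1) - 1 \<le> real (hom_count (complete_graph m) H_WR)"
proof -
  define A where "A = {..<m} \<rightarrow>\<^sub>E {0, 1 :: nat}"
  define B where "B = {..<m} \<rightarrow>\<^sub>E {1, 2 :: nat}"
  have fin: "finite A" "finite B" by (auto simp: A_def B_def finite_PiE)
  have "A \<inter> B = {..<m} \<rightarrow>\<^sub>E ({0, 1} \<inter> {1, 2})" unfolding A_def B_def by (rule PiE_Int)
  then have "card (A \<inter> B) = 1" by (simp add: card_PiE)
  moreover have "card A = 2 ^ m" "card B = 2 ^ m" by (simp_all add: A_def B_def card_PiE numeral_2_eq_2)
  ultimately have "2 * 2 ^ m = card (A \<union> B) + 1" using card_Un_Int[OF fin] by simp
  moreover have "card (A \<union> B) \<le> hom_count (complete_graph m) H_WR"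
    unfolding hom_count_def
  proof (rule card_mono)
    have "graph_homs (complete_graph m) H_WR \<subseteq> {..<m} \<rightarrow>\<^sub>E {0, 1, 2}"
      by (auto simp: graph_homs_def complete_graph_def H_WR_def)
    then show "finite (graph_homs (complete_graph m) H_WR)"
      by (rule finite_subset) (simp add: finite_PiE)
    have hom: "{..<m} \<rightarrow>\<^sub>E S \<subseteq> graph_homs (complete_graph m) H_WR"
      if S: "S \<subseteq> {0, 1, 2}" "S \<times> S \<subseteq> parcs H_WR" for S
    proof
      fix f assume f: "f \<in> {..<m} \<rightarrow>\<^sub>E S"
      then have "f \<in> {..<m} \<rightarrow>\<^sub>E {0, 1, 2}" using PiE_mono[of "{..<m}" "\<lambda>_. S"] S(1) by blast
      moreover have "(f u, f v) \<in> parcs H_WR" if "u < m" "v < m" for u v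
        using PiE_mem[OF f] S(2) that by blast
      ultimately show "f \<in> graph_homs (complete_graph m) H_WR"
        unfolding graph_homs_def by (simp add: complete_graph_def H_WR_def)
    qed
    show "A \<union> B \<subseteq> graph_homs (complete_graph m) H_WR"
      unfolding A_def B_def by (intro Un_least hom) (auto simp: H_WR_def)
  qed
  ultimately have "2 * 2 ^ m \<le> hom_count (complete_graph m) H_WR + 1" by linarith
  then have "real (2 * 2 ^ m) \<le> real (hom_count (complete_graph m) H_WR + 1)"
    unfolding of_nat_le_iff .
  then show ?thesis by simp
qed

theorem theorem1p7:
  shows "\<exists>C::real. C > 0 \<and>
    (\<forall>\<^sub>F d::nat in sequentially.
      \<forall>(G :: 'a pair_pre_digraph) (n::nat).
        pair_graph G \<and> pverts G \<noteq> {} \<and> card (pverts G) = n \<and> regular_graph d G \<and>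
        (\<exists>I. independent_set G I \<and> real (card I) \<ge> C * real n / real d) \<longrightarrow>
        real (hom_count G H_WR)
          < real (hom_count (complete_graph (d + 1)) H_WR) powr (real n / real (d + 1)))"
proof (intro exI[of _ 40] conjI eventually_mono[OF eventually_gt_at_top[of 0]] allI impI)
  \<comment> \<open>The constant 40 is the one in \<open>strict_bound_from_independence\<close>, and
    every \<open>d > 0\<close> is large enough.\<close>
  fix d n :: nat and G :: "'a pair_pre_digraph"
  assume d: "0 < d"
  assume "pair_graph G \<and> pverts G \<noteq> {} \<and> card (pverts G) = n \<and> regular_graph d G \<and>
        (\<exists>I. independent_set G I \<and> real (card I) \<ge> 40 * real n / real d)"
  then obtain I where G: "pair_graph G" "pverts G \<noteq> {}" "card (pverts G) = n" "regular_graph d G"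
    and I: "independent_set G I" "real (card I) \<ge> 40 * real n / real d" by blast
  interpret pair_graph G by fact
  define M where "M = real (hom_count (complete_graph (d + 1)) H_WR)"
  have M: "2 ^ (d + 2) - 1 \<le> M"
    using hom_count_complete_graph_H_WR_ge[of "d + 1"] by (simp add: M_def)
  moreover have "(2 :: real) ^ (d + 2) > 1" by (rule one_less_power) auto
  ultimately have M0: "M > 0" by linarith
  have n: "n > 0" using G pair_finite_verts by (auto simp: card_gt_0_iff)
  have sym: "sym (parcs G)" using arcs_symmetric by (auto intro: symI)
  have irr: "irrefl (parcs G)" using pair_no_loops by (force simp: irrefl_def)
  have sub: "parcs G \<subseteq> pverts G \<times> pverts G" using in_arcsD1 in_arcsD2 by auto
  \<comment> \<open>Regularity speaks of outgoing arcs, the bound of incoming ones; symmetry of the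
    arcs matches them.\<close>
  have deg: "card {u. (u, v) \<in> parcs G} = d" if "v \<in> pverts G" for v
  proof -
    have "bij_betw (\<lambda>u. (v, u)) {u. (u, v) \<in> parcs G} (out_arcs (with_proj G) v)"
      by (rule bij_betwI[where g = snd]) (auto intro: arcs_symmetric)
    then have "card {u. (u, v) \<in> parcs G} = out_degree (with_proj G) v"
      unfolding out_degree_def by (rule bij_betw_same_card)
    then show ?thesis using G(4) that by (simp add: regular_graph_def)
  qed
  have homs: "graph_homs G H_WR
    = {f \<in> pverts G \<rightarrow>\<^sub>E {0, 1, 2}. \<forall>(u, v)\<in>parcs G. (f u, f v) \<in> parcs H_WR}"
    by (simp add: graph_homs_def H_WR_def)
  have I': "I \<subseteq> pverts G" "\<And>u v. u \<in> I \<Longrightarrow> v \<in> I \<Longrightarrow> (u, v) \<notin> parcs G"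
    using I(1) by (auto simp: independent_set_def)
  note bound = regular_WR_count_bound[OF pair_finite_verts sym irr sub deg I' homs]
  have "finite (graph_homs G H_WR)"
    unfolding homs using pair_finite_verts by (simp add: finite_PiE)
  then have pos: "real (hom_count G H_WR) > 0"
    using bound(1) by (simp add: hom_count_def card_gt_0_iff)
  have "ln (real (hom_count G H_WR)) < real n / (real d + 1) * ln M"
    using bound(2) G(3)
    by (intro strict_bound_from_independence[OF d n _ I(2) M]) (simp add: hom_count_def)
  then have "exp (ln (real (hom_count G H_WR))) < exp (real n / (real d + 1) * ln M)"
    by (simp only: exp_less_cancel_iff)
  then show "real (hom_count G H_WR) < M powr (real n / real (d + 1))"
    unfolding M_def[symmetric] using pos M0 by (simp add: powr_def add.commute)
qed simp

end
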